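(* Let $\mu\in(0,1)$, let $p_1<p_2$ be real numbers, and let $u_0$ be such that $\mathcal{F}u_0\equiv0$ on $\mathbb{R}\setminus[p_1,p_2]$ and $\mathcal{F}u_0(p)=(p-p_1)^{\mu-1}\tilde u(p)$ for $p\in(p_1,p_2]$, where $\tilde u\in\mathcal{C}^1([p_1,p_2],\mathbb{C})$, $\tilde u(p_1)\neq0$ and $\mathcal{F}u_0(p_2)=0$. Let $u$ be the solution of the free Schrödinger equation with initial datum $u_0$ (see context). Then for all $(t,x)$ such that $t>0$ and $x=2p_1t$, there exists $L_\mu(t,u_0)\in\mathbb{C}$ satisfying $$\left|u(t,x)-L_\mu(t,u_0)\,t^{-\frac\mu2}\right|\leqslant c(u_0)\left(t^{-1}+t^{-\frac12}\right).$$ The coefficient $L_\mu(t,u_0)$ and the constant $c(u_0)\geqslant0$ are defined by $$L_\mu(t,u_0):=\frac{1}{2}\,\Gamma\Big(\frac\mu2\Big)\,e^{-i\frac{\pi\mu}{4}}\,e^{itp_1^2}\,\tilde u(p_1),$$ $$c(u_0):=\frac{(p_2-p_1)^2}{2}\,\eta^{\mu-3}\,\|\tilde u\|_{W^{1,\infty}(p_1,p_2)}\Big(\|\nu'\|_{L^\infty(p_1,p_2)}+(2-\mu)\,\eta^{-1}+1\Big)+\frac{\sqrt\pi}{2\mu}\,(p_2-p_1)^\mu\,\|\tilde u\|_{W^{1,\infty}(p_1,p_2)}\Big(\|\nu'\|_{L^\infty(p_1,p_2)}+1\Big),$$ where $\eta\in\big(0,\frac{p_2-p_1}{2}\big)$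 is a fixed number and $\nu$ is a smooth cut-off function associated with $\eta$ (see context).
   Context: The free Schrödinger equation on the line is $[i\partial_t+\partial_x^2]u(t,x)=0$ for $t>0$, $x\in\mathbb{R}$, with $u(0,x)=u_0(x)$. The Fourier transform convention is $\mathcal{F}u_0(p)=\int_{\mathbb{R}}u_0(x)e^{-ixp}\,dx$. For $u_0$ as in the claim, the solution is given by $$u(t,x)=\frac{1}{2\pi}\int_{p_1}^{p_2}\mathcal{F}u_0(p)\,e^{-itp^2+ixp}\,dp,\qquad t>0,\ x\in\mathbb{R}.$$ The cut-off function $\nu:[p_1,p_2]\to\mathbb{R}$ is smooth with $0\leqslant\nu\leqslant1$, $\nu=1$ on $[p_1,p_1+\eta]$ and $\nu=0$ on $[p_2-\eta,p_2]$. $\Gamma$ is the Gamma function and $\|\cdot\|_{W^{1,\infty}(p_1,p_2)}$ is the usual Sobolev norm.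
   Formalization: The coefficient L_μ(t,u_0) carries an additional factor 1/(2π): with u normalised by 1/(2π), the printed L_μ t^{-μ/2} is the leading term of 2πu, so the printed inequality fails as t→∞ for every admissible u_0. *)

theory Defs
  imports "HOL-Probability.Essential_Supremum"
begin

text \<open>
  The data \<open>u\<^sub>0\<close> considered here are never Lebesgue integrable, since their Fourier transform is
  unbounded near \<open>p\<^sub>1\<close>; they decay like \<open>\<bar>x\<bar>\<close> to the power \<open>-\<mu>\<close>.  The integral over the line is
  therefore the Henstock-Kurzweil one, which contains the conditionally convergent improper
  integrals.  It is \<open>0\<close> by convention where it does not converge (for the data at hand, only
  at \<open>p = p\<^sub>1\<close>, about which nothing is assumed).
\<close>

definition fourier_transform :: "(real \<Rightarrow> complex) \<Rightarrow> real \<Rightarrow> complex" where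
  "fourier_transform u0 p =
     integral UNIV (\<lambda>x. u0 x * exp (- (\<i> * complex_of_real (x * p))))"

text \<open>Solution of \<open>(\<i> \<partial>\<^sub>t + \<partial>\<^sub>x\<^sup>2) u = 0\<close>, \<open>u(0, x) = u\<^sub>0(x)\<close> for data with Fourier transform supported
  in \<open>[p1, p2]\<close>.\<close>

definition schroedinger_solution ::
    "real \<Rightarrow> real \<Rightarrow> (real \<Rightarrow> complex) \<Rightarrow> real \<Rightarrow> real \<Rightarrow> complex" where
  "schroedinger_solution p1 p2 u0 t x =
     1 / (2 * complex_of_real pi) *
     integral {p1..p2}
       (\<lambda>p. fourier_transform u0 p *
            exp (- (\<i> * complex_of_real (t * p\<^sup>2)) + \<i> * complex_of_real (x * p)))"

text \<open>Class \<open>C\<^sup>k\<close> on a set \<open>S\<close>, used for closed intervals: derivatives are taken within \<open>S\<close>, hence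
  one-sided at the end points, and values outside \<open>S\<close> are irrelevant.\<close>

primrec Ck_on :: "nat \<Rightarrow> (real \<Rightarrow> 'a::real_normed_vector) \<Rightarrow> real set \<Rightarrow> bool" where
  "Ck_on 0 f S \<longleftrightarrow> continuous_on S f"
| "Ck_on (Suc k) f S \<longleftrightarrow>
     (\<exists>f'. (\<forall>x\<in>S. (f has_vector_derivative f' x) (at x within S)) \<and> Ck_on k f' S)"

definition smooth_on :: "(real \<Rightarrow> 'a::real_normed_vector) \<Rightarrow> real set \<Rightarrow> bool" where
  "smooth_on f S \<longleftrightarrow> (\<forall>k. Ck_on k f S)"

definition cutoff :: "real \<Rightarrow> real \<Rightarrow> real \<Rightarrow> (real \<Rightarrow> real) \<Rightarrow> bool" where
  "cutoff p1 p2 \<eta> \<nu> \<longleftrightarrow>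
     smooth_on \<nu> {p1..p2} \<and>
     (\<forall>p\<in>{p1..p2}. 0 \<le> \<nu> p \<and> \<nu> p \<le> 1) \<and>
     (\<forall>p\<in>{p1..p1 + \<eta>}. \<nu> p = 1) \<and>
     (\<forall>p\<in>{p2 - \<eta>..p2}. \<nu> p = 0)"

text \<open>Both norms below are only applied to functions for which the essential suprema are finite.
  For \<open>W\<^sup>1\<^sup>,\<^sup>\<infinity>\<close> the maximum convention is used; it is dominated by the sum convention, so an upper
  bound in terms of it implies the bound with the sum.\<close>

definition Linf_norm :: "real \<Rightarrow> real \<Rightarrow> (real \<Rightarrow> 'a::real_normed_vector) \<Rightarrow> real" where
  "Linf_norm a b f = real_of_ereal (esssup (lebesgue_on {a<..<b}) (\<lambda>x. ereal (norm (f x))))"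

definition W1inf_norm :: "real \<Rightarrow> real \<Rightarrow> (real \<Rightarrow> 'a::real_normed_vector) \<Rightarrow> real" where
  "W1inf_norm a b f =
     max (Linf_norm a b f) (Linf_norm a b (\<lambda>x. vector_derivative f (at x)))"

text \<open>
  In the source the coefficient is stated without the leading factor \<open>1 / (2 \<pi>)\<close>.  It is forced by
  the \<open>1 / (2 \<pi>)\<close> in \<^const>\<open>schroedinger_solution\<close>: on the ray \<open>x = 2 p\<^sub>1 t\<close> the phase is
  \<open>t p\<^sub>1\<^sup>2 - t (p - p\<^sub>1)\<^sup>2\<close>, and the integral of \<open>s\<close> to the \<open>\<mu> - 1\<close> times \<open>exp (- \<i> t s\<^sup>2)\<close> over
  \<open>s > 0\<close> is \<open>\<Gamma>(\<mu>/2) / 2\<close> times \<open>(\<i> t)\<close> to the \<open>- \<mu> / 2\<close>.  Without the factor the remainder would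
  be of the order of \<open>t\<close> to the \<open>- \<mu> / 2\<close>, which is not \<open>O\<close> of \<open>t\<close> to the \<open>- 1 / 2\<close>.
\<close>

definition L_coeff :: "real \<Rightarrow> real \<Rightarrow> (real \<Rightarrow> complex) \<Rightarrow> real \<Rightarrow> complex" where
  "L_coeff \<mu> p1 ut t =
     1 / (2 * complex_of_real pi) *
     (1 / 2 * complex_of_real (Gamma (\<mu> / 2)) * exp (- (\<i> * complex_of_real (pi * \<mu> / 4)))
       * exp (\<i> * complex_of_real (t * p1\<^sup>2)) * ut p1)"

definition c_const ::
    "real \<Rightarrow> real \<Rightarrow> real \<Rightarrow> real \<Rightarrow> (real \<Rightarrow> real) \<Rightarrow> (real \<Rightarrow> complex) \<Rightarrow> real" where
  "c_const \<mu> p1 p2 \<eta> \<nu> ut =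
     (p2 - p1)\<^sup>2 / 2 * \<eta> powr (\<mu> - 3) * W1inf_norm p1 p2 ut
       * (Linf_norm p1 p2 (deriv \<nu>) + (2 - \<mu>) * inverse \<eta> + 1)
     + sqrt pi / (2 * \<mu>) * (p2 - p1) powr \<mu> * W1inf_norm p1 p2 ut
       * (Linf_norm p1 p2 (deriv \<nu>) + 1)"

end

theory Submission
  imports Defs
begin

text \<open>
  On the ray \<open>x = 2 p1 t\<close> the substitution \<open>p = p1 + s\<close> turns \<open>2 \<pi> u\<close>, up to a unimodular factor, into
  \<open>\<integral> s\<^bsup>\<mu> - 1\<^esup> f(s) exp (- l s\<^sup>2) ds\<close> over \<open>[0, q]\<close> with \<open>q = p2 - p1\<close>, \<open>l = \<i> t\<close> and \<open>f(q) = 0\<close>.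
  For \<open>Re l > 0\<close> subtract \<open>f(0)\<close> times the moment \<open>\<Gamma>(\<mu>/2) / 2 \<cdot> l\<^bsup>-\<mu>/2\<^esup>\<close> of the Gaussian on the half-line,
  and integrate by parts against \<open>E(s) = \<integral> exp (- l \<sigma>\<^sup>2) d\<sigma>\<close> over \<open>[s, R]\<close>, which is at most
  \<open>2 / sqrt \<bar>l\<bar>\<close>.  As \<open>f(q) = 0\<close>, the boundary terms at \<open>q\<close> cancel, and
  \<open>\<bar>f(s) - f(0)\<bar> \<le> W s\<close> makes the remaining integrals converge.  The bound
  \<open>4 W q\<^sup>\<mu> / (\<mu> sqrt \<bar>l\<bar>)\<close> so obtained is uniform in \<open>l\<close>, hence survives the limit \<open>l \<rightarrow> \<i> t\<close>, and after
  division by \<open>2 \<pi>\<close> it is below the second summand of \<open>c(u\<^sub>0)\<close>.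
\<close>

section \<open>Gaussian moments on the half-line, for real and complex parameter\<close>

text \<open>Euler's integral for \<open>Gamma x\<close> under the substitution
  \<open>y = a * s^2\<close>. It is carried out on the open half-line, which the substitution maps
  bijectively onto itself; the point 0 is negligible.\<close>

lemma has_integral_gauss_moment:
  fixes a x :: real
  assumes "a > 0" "x > 0"
  shows "((\<lambda>s. s powr (2 * x - 1) * exp (- (a * s\<^sup>2))) has_integral
           (Gamma x / (2 * a powr x))) {0..}"
proof -
  define f :: "real \<Rightarrow> real" where "f = (\<lambda>y. y powr (x - 1) / exp y)"
  define g where "g = (\<lambda>s::real. a * s\<^sup>2)"
  have f: "(f has_integral Gamma x) {0<..}"
    using Gamma_integral_real[OF \<open>x > 0\<close>] unfolding f_def
    by (subst has_integral_spike_set_eq[of "{0<..}" "{0..}"])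
      (rule negligible_subset[of "{0::real}"]; force)+
  have img: "g ` {0<..} = {0<..}"
  proof -
    have "y \<in> g ` {0<..}" if "y > 0" for y
      using that \<open>a > 0\<close> by (intro image_eqI[of _ _ "sqrt (y / a)"]) (auto simp: g_def)
    with \<open>a > 0\<close> show ?thesis by (auto simp: g_def)
  qed
  have abs: "f absolutely_integrable_on {0<..}"
    using f by (intro nonnegative_absolutely_integrable_1) (auto simp: f_def has_integral_iff)
  have der: "(g has_field_derivative 2 * a * s) (at s within {0<..})" for s
    unfolding g_def by (auto intro!: derivative_eq_intros)
  have inj: "inj_on g {0<..}"
    using \<open>a > 0\<close> by (auto simp: g_def inj_on_def)
  have "(\<lambda>s. \<bar>2 * a * s\<bar> * f (g s)) absolutely_integrable_on {0<..} \<and>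
        integral {0<..} (\<lambda>s. \<bar>2 * a * s\<bar> * f (g s)) = Gamma x"
    by (subst has_absolute_integral_change_of_variables_1'[OF _ der inj])
      (use abs f img in \<open>auto simp: has_integral_iff\<close>)
  then have "((\<lambda>s. \<bar>2 * a * s\<bar> * f (g s)) has_integral Gamma x) {0<..}"
    by (simp add: has_integral_iff absolutely_integrable_on_def)
  then have "((\<lambda>s. inverse (2 * a powr x) * (\<bar>2 * a * s\<bar> * f (g s))) has_integral
      inverse (2 * a powr x) * Gamma x) {0<..}"
    by (rule has_integral_mult_right)
  then have "((\<lambda>s. s powr (2 * x - 1) * exp (- (a * s\<^sup>2))) has_integral
      inverse (2 * a powr x) * Gamma x) {0<..}"
  proof (rule has_integral_eq[rotated])
    fix s :: real assume s: "s \<in> {0<..}"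
    have "(a * s\<^sup>2) powr (x - 1) = a powr x / a * (s powr (2 * x) / s\<^sup>2)"
      using s \<open>a > 0\<close> by (simp add: powr_mult powr_diff powr_powr flip: powr_numeral)
    then show "inverse (2 * a powr x) * (\<bar>2 * a * s\<bar> * f (g s)) = s powr (2 * x - 1) * exp (- (a * s\<^sup>2))"
      using s \<open>a > 0\<close>
      by (simp add: f_def g_def exp_minus powr_diff field_simps power2_eq_square)
  qed
  then have "((\<lambda>s. s powr (2 * x - 1) * exp (- (a * s\<^sup>2))) has_integral
      inverse (2 * a powr x) * Gamma x) {0..}"
    by (subst has_integral_spike_set_eq[of "{0..}" "{0<..}"])
      (rule negligible_subset[of "{0::real}"]; force)+
  then show ?thesis
    by (simp only: divide_inverse mult.commute[of "Gamma x"])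
qed

lemma has_integral_gauss_moment_complex:
  fixes l :: complex and x :: real
  assumes l: "Re l > 0" and x: "x > 0"
  shows "((\<lambda>s. of_real (s powr (2 * x - 1)) * exp (- (l * of_real (s\<^sup>2)))) has_integral
           (of_real (Gamma x) / 2 * l powr (- of_real x))) {0..}"
proof -
  \<comment> \<open>\<open>a\<close> is so large that the disc of radius \<open>a\<close> about \<open>a\<close> contains \<open>l\<close>: there the exponential series
    in \<open>l - a\<close> may be integrated termwise, and the moments at \<open>a\<close> yield the binomial series.\<close>
  define a where "a = (norm l)\<^sup>2 / Re l"
  have a: "a > 0" using l by (auto simp: a_def intro!: divide_pos_pos)
  define h where "h = l - of_real a"
  \<comment> \<open>By the choice of \<open>a\<close>, \<open>2 * a * Re l\<close> is twice
    \<open>|l|^2\<close>, so \<open>|h|^2 = a^2 - |l|^2\<close>.\<close>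
  have "(norm h)\<^sup>2 = (norm l)\<^sup>2 - 2 * a * Re l + a\<^sup>2"
    unfolding h_def cmod_power2 by (simp add: power2_eq_square algebra_simps)
  also have "\<dots> < a\<^sup>2"
    using l by (auto simp: a_def)
  finally have h: "norm h < a"
    using a by (simp add: power2_less_imp_less)
  define w where "w = (\<lambda>s. s powr (2 * x - 1) * exp (- (a * s\<^sup>2)))"
  define S where "S = (\<lambda>k s. of_real (w s) * (\<Sum>n<k. (- h * of_real (s\<^sup>2)) ^ n /\<^sub>R fact n))"
  define T where "T = (\<lambda>s. of_real (s powr (2 * x - 1)) * exp (- (l * of_real (s\<^sup>2))))"
  define c where "c = of_real (Gamma x / (2 * a powr x)) * (1 + h / of_real a) powr (- of_real x)"
  \<comment> \<open>The real moment with \<open>x + n\<close> in place of \<open>x\<close>. At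
    \<open>s = 0\<close> both integrands vanish, since \<open>0 powr y = 0\<close> for every
    \<open>y\<close>.\<close>
  have moment: "((\<lambda>s. w s * s ^ (2 * n)) has_integral
      Gamma x / (2 * a powr x) * (pochhammer x n / a ^ n)) {0..}" for n
  proof -
    have "Gamma (x + n) = Gamma x * pochhammer x n"
      using x Gamma_real_pos[OF x, THEN less_imp_neq]
      by (subst pochhammer_Gamma) (auto simp: nonpos_Ints_def)
    then have "Gamma (x + n) / (2 * a powr (x + n)) = Gamma x / (2 * a powr x) * (pochhammer x n / a ^ n)"
      using a by (simp add: powr_add powr_realpow)
    moreover have "s powr (2 * (x + n) - 1) * exp (- (a * s\<^sup>2)) = w s * s ^ (2 * n)" if "s \<in> {0..}" for s
    proof (cases "s = 0")
      case False
      then have "s powr (2 * (x + n) - 1) = s powr (2 * x - 1) * s powr real (2 * n)"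
        by (simp flip: powr_add add: algebra_simps)
      with False that powr_realpow[of s "2 * n"] show ?thesis by (simp add: w_def)
    qed (simp add: w_def)
    moreover have "((\<lambda>s. s powr (2 * (x + n) - 1) * exp (- (a * s\<^sup>2))) has_integral
        Gamma (x + n) / (2 * a powr (x + n))) {0..}"
      using x by (intro has_integral_gauss_moment a) auto
    ultimately show ?thesis by (metis (no_types, lifting) has_integral_eq)
  qed
  have S_int: "(S k has_integral
      of_real (Gamma x / (2 * a powr x)) * (\<Sum>n<k. (- of_real x gchoose n) * (h / of_real a) ^ n)) {0..}" for k
  proof -
    have "((\<lambda>s. (- h) ^ n / fact n * of_real (w s * s ^ (2 * n))) has_integral
        (- h) ^ n / fact n * of_real (Gamma x / (2 * a powr x) * (pochhammer x n / a ^ n))) {0..}" for n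
      by (intro has_integral_mult_right has_integral_of_real moment)
    then have sum: "((\<lambda>s. \<Sum>n<k. (- h) ^ n / fact n * of_real (w s * s ^ (2 * n))) has_integral
        (\<Sum>n<k. (- h) ^ n / fact n * of_real (Gamma x / (2 * a powr x) * (pochhammer x n / a ^ n)))) {0..}"
      by (intro has_integral_sum) auto
    have S_eq: "(\<Sum>n<k. (- h) ^ n / fact n * of_real (w s * s ^ (2 * n))) = S k s" for s
      unfolding S_def sum_distrib_left
      by (intro sum.cong refl)
        (simp only: power_mult_distrib of_real_mult of_real_power power_mult[symmetric] scaleR_conv_of_real
          of_real_inverse of_real_fact divide_inverse mult_ac)
    have coeff: "(- h) ^ n / fact n * of_real (Gamma x / (2 * a powr x) * (pochhammer x n / a ^ n)) =
        of_real (Gamma x / (2 * a powr x)) * ((- of_real x gchoose n) * (h / of_real a) ^ n)" for n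
    proof -
      have *: "- of_real x gchoose n = (- 1) ^ n * of_real (pochhammer x n) / (fact n :: complex)"
        by (simp add: gbinomial_pochhammer pochhammer_of_real)
      show ?thesis
        unfolding * power_minus[of h] power_divide of_real_mult of_real_divide[of "pochhammer x n"]
          of_real_power of_real_inverse divide_inverse power_mult_distrib power_inverse
        by (simp only: mult_ac)
    qed
    show ?thesis
      using sum unfolding S_eq coeff sum_distrib_left .
  qed
  \<comment> \<open>The triangle inequality costs at most the factor \<open>exp (|h| * s^2)\<close>.
    As \<open>|h| < a\<close>, a real Gaussian remains that dominates all partial sums at
    once.\<close>
  have dom: "norm (S k s) \<le> s powr (2 * x - 1) * exp (- ((a - norm h) * s\<^sup>2))" for k s
  proof -
    have "norm (\<Sum>n<k. (- h * of_real (s\<^sup>2)) ^ n /\<^sub>R fact n) \<le> (\<Sum>n<k. (norm h * s\<^sup>2) ^ n /\<^sub>R fact n)"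
      by (intro sum_norm_le) (simp add: norm_power norm_mult)
    also have "\<dots> \<le> exp (norm h * s\<^sup>2)"
      unfolding exp_def by (intro sum_le_suminf summable_exp_generic) auto
    finally have "norm (S k s) \<le> w s * exp (norm h * s\<^sup>2)"
      by (simp add: S_def norm_mult w_def mult_left_mono)
    also have "\<dots> = s powr (2 * x - 1) * exp (- ((a - norm h) * s\<^sup>2))"
      by (simp add: w_def algebra_simps flip: exp_add)
    finally show ?thesis .
  qed
  have lim: "(\<lambda>k. S k s) \<longlonglongrightarrow> T s" for s
  proof -
    have "(\<lambda>k. S k s) \<longlonglongrightarrow> of_real (w s) * exp (- h * of_real (s\<^sup>2))"
      unfolding S_def using exp_converges[of "- h * of_real (s\<^sup>2)"]
      by (intro tendsto_mult tendsto_const) (simp add: sums_def)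
    also have "of_real (w s) * exp (- h * of_real (s\<^sup>2)) = T s"
      by (simp add: w_def T_def h_def algebra_simps flip: exp_of_real exp_add)
    finally show ?thesis .
  qed
  have domI: "(\<lambda>s. s powr (2 * x - 1) * exp (- ((a - norm h) * s\<^sup>2))) integrable_on {0..}"
    using has_integral_gauss_moment[of "a - norm h" x] h x by (auto simp: has_integral_iff)
  note dc = dominated_convergence[of S, OF has_integral_integrable[OF S_int] domI dom lim]
  have "(\<lambda>k. integral {0..} (S k)) \<longlonglongrightarrow> c"
    unfolding integral_unique[OF S_int] c_def
    using gen_binomial_complex[of "h / of_real a" "- of_real x"] h a
    by (intro tendsto_mult tendsto_const) (simp add: sums_def norm_divide)
  with dc(2) have "integral {0..} T = c" by (rule LIMSEQ_unique)
  also have "c = of_real (Gamma x) / 2 * l powr (- of_real x)"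
  proof -
    \<comment> \<open>The power of this product splits without a branch correction because the
      factor \<open>a\<close> is a positive real.\<close>
    have "l = of_real a * (1 + h / of_real a)" using a by (simp add: h_def field_simps)
    then have "l powr (- of_real x) = of_real a powr (- of_real x) * (1 + h / of_real a) powr (- of_real x)"
      using a by (metis Re_complex_of_real Reals_of_real less_imp_le powr_times_real_left)
    moreover have "complex_of_real a powr (- of_real x) = inverse (of_real (a powr x))"
      using a by (simp add: powr_minus powr_of_real)
    ultimately show ?thesis by (simp add: c_def field_simps)
  qed
  finally show ?thesis using dc(1) by (simp add: has_integral_iff T_def)
qed

section \<open>Bounds for incomplete Gaussian integrals, uniform up to the imaginary axis\<close>

text \<open>Integration by parts against the derivative \<open>-2 l s e(s)\<close> of
  \<open>e\<close>, written as \<open>A' = e + B\<close>. Since \<open>|e| \<le> 1\<close>, the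
  boundary terms give \<open>1/(2|l|a) + 1/(2|l|b)\<close> and \<open>B\<close> gives
  \<open>(1/a - 1/b)/(2|l|)\<close>; the terms in \<open>1/b\<close> cancel.\<close>

lemma norm_integral_gauss_le_away:
  fixes l :: complex
  assumes l: "Re l \<ge> 0" "l \<noteq> 0" and a: "0 < a" "a \<le> b"
  shows "norm (integral {a..b} (\<lambda>s. exp (- (l * of_real (s\<^sup>2))))) \<le> 1 / (norm l * a)"
proof -
  define e where "e = (\<lambda>s::real. exp (- (l * of_real (s\<^sup>2))))"
  define A where "A = (\<lambda>s::real. - e s / (2 * l * of_real s))"
  define B where "B = (\<lambda>s::real. e s / (2 * l * of_real (s\<^sup>2)))"
  have e_le: "norm (e s) \<le> 1" for s
    using l by (simp add: e_def)
  have contB: "continuous_on {a..b} B" "continuous_on {a..b} e"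
    unfolding B_def e_def using a l by (auto intro!: continuous_intros)
  have "(A has_vector_derivative e s + B s) (at s within {a..b})" if "s \<in> {a..b}" for s
    unfolding A_def B_def e_def using that a l
    by (auto intro!: derivative_eq_intros has_vector_derivative_real_field simp: field_simps power2_eq_square)
  then have "((\<lambda>s. e s + B s) has_integral A b - A a) {a..b}"
    using a by (intro fundamental_theorem_of_calculus) auto
  then have "integral {a..b} (\<lambda>s. e s + B s) = A b - A a" by (rule integral_unique)
  moreover have "integral {a..b} (\<lambda>s. e s + B s) = integral {a..b} e + integral {a..b} B"
    by (intro integral_add integrable_continuous_real contB)
  ultimately have eq: "integral {a..b} e = A b - A a - integral {a..b} B" by (simp add: algebra_simps)
  have A_le: "norm (A s) \<le> 1 / (2 * norm l * s)" if "s > 0" for s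
    using that e_le[of s] by (simp add: A_def norm_divide norm_mult divide_right_mono)
  have "((\<lambda>s. 1 / (2 * norm l) * (1 / s\<^sup>2)) has_integral 1 / (2 * norm l) * ((- 1 / b) - (- 1 / a))) {a..b}"
    using a
    by (intro has_integral_mult_right fundamental_theorem_of_calculus)
      (auto intro!: derivative_eq_intros simp: power2_eq_square simp flip: has_real_derivative_iff_has_vector_derivative)
  moreover have "norm (B s) \<le> 1 / (2 * norm l) * (1 / s\<^sup>2)" for s
    using e_le[of s] by (simp add: B_def norm_divide norm_mult norm_power divide_right_mono)
  ultimately have "norm (integral {a..b} B) \<le> 1 / (2 * norm l) * ((- 1 / b) - (- 1 / a))"
    by (intro integral_norm_bound_integral[THEN order_trans, OF integrable_continuous_real[OF contB(1)]])
      (auto simp: has_integral_iff)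
  moreover have "norm (integral {a..b} e) \<le> norm (A b) + norm (A a) + norm (integral {a..b} B)"
    unfolding eq by norm
  ultimately have "norm (integral {a..b} e) \<le>
      1 / (2 * norm l * b) + 1 / (2 * norm l * a) + 1 / (2 * norm l) * ((- 1 / b) - (- 1 / a))"
    using A_le[of a] A_le[of b] a by linarith
  also have "\<dots> = 1 / (norm l * a)"
    using a l by (simp add: field_simps)
  finally show ?thesis by (simp add: e_def)
qed

text \<open>The interval is cut at \<open>c = 1 / sqrt |l|\<close>, where the trivial bound by the
  length and the bound \<open>1/(|l|c)\<close> agree. Each piece contributes at most
  \<open>c\<close>.\<close>

lemma norm_integral_gauss_le:
  fixes l :: complex
  assumes l: "Re l \<ge> 0" "l \<noteq> 0" and a: "0 \<le> a" "a \<le> b"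
  shows "norm (integral {a..b} (\<lambda>s. exp (- (l * of_real (s\<^sup>2))))) \<le> 2 / sqrt (norm l)"
proof -
  define e where "e = (\<lambda>s::real. exp (- (l * of_real (s\<^sup>2))))"
  define c where "c = 1 / sqrt (norm l)"
  have c: "c > 0" and lc: "1 / (norm l * c) = c"
    using l by (auto simp: c_def field_simps)
  have cont: "continuous_on X e" for X unfolding e_def by (intro continuous_intros)
  have near: "norm (integral {u..v} e) \<le> c" if "0 \<le> u" "u \<le> v" "v \<le> c" for u v
  proof -
    have "norm (integral {u..v} e) \<le> 1 * (v - u)"
      using that l by (intro integral_bound cont) (auto simp: e_def)
    with that show ?thesis by simp
  qed
  have far: "norm (integral {u..v} e) \<le> c" if "c \<le> u" "u \<le> v" for u v
  proof -
    have "norm (integral {u..v} e) \<le> 1 / (norm l * u)"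
      using that c norm_integral_gauss_le_away[OF l, of u v] by (simp add: e_def)
    also have "\<dots> \<le> 1 / (norm l * c)"
      using that c l by (intro divide_left_mono mult_left_mono mult_pos_pos) auto
    finally show ?thesis by (simp add: lc)
  qed
  have "norm (integral {a..b} e) \<le> 2 * c"
  proof -
    consider "b \<le> c" | "c \<le> a" | "a \<le> c" "c \<le> b" by linarith
    then show ?thesis
    proof cases
      case 3
      have "integral {a..b} e = integral {a..c} e + integral {c..b} e"
        using 3 by (intro Henstock_Kurzweil_Integration.integral_combine[symmetric] integrable_continuous_real cont) auto
      then show ?thesis
        using norm_triangle_ineq[of "integral {a..c} e" "integral {c..b} e"] near[of a c] far[of c b] a 3
        by simp
    qed (use near[of a b] far[of a b] a c in linarith)+
  qed
  then show ?thesis by (simp add: e_def c_def)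
qed

section \<open>The remainder estimate by integration by parts\<close>

lemma has_integral_norm_le:
  fixes f :: "'a::euclidean_space \<Rightarrow> 'b::banach"
  assumes "(f has_integral i) S" "(g has_integral j) S" "\<And>x. x \<in> S \<Longrightarrow> norm (f x) \<le> g x"
  shows "norm i \<le> j"
  using integral_norm_bound_integral[of f S g] assms by (auto simp: has_integral_iff)

lemma integrable_powr_mult_continuous:
  fixes \<phi> :: "real \<Rightarrow> complex"
  assumes "a > 0" "continuous_on {0..q} \<phi>"
  shows "(\<lambda>s. of_real (s powr (a - 1)) * \<phi> s) integrable_on {0..q}"
proof (cases "q \<ge> 0")
  case True
  obtain M where M: "\<And>s. s \<in> {0..q} \<Longrightarrow> norm (\<phi> s) \<le> M"
    using compact_imp_bounded[OF compact_continuous_image[OF assms(2) compact_Icc]]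
    unfolding bounded_iff by blast
  show ?thesis
  proof (rule measurable_bounded_by_integrable_imp_integrable)
    have "\<phi> \<in> borel_measurable (lebesgue_on {0..q})"
      using assms(2) by (intro continuous_imp_measurable_on_sets_lebesgue) auto
    moreover have "(\<lambda>s. complex_of_real (s powr (a - 1))) \<in> borel_measurable (lebesgue_on {0..q})"
      by (intro borel_measurable_if_D measurable_restrict_space1 measurable_completion) measurable
    ultimately show "(\<lambda>s. of_real (s powr (a - 1)) * \<phi> s) \<in> borel_measurable (lebesgue_on {0..q})"
      by (rule borel_measurable_times[rotated])
    show "(\<lambda>s. M * s powr (a - 1)) integrable_on {0..q}"
      using assms(1) True by (intro integrable_on_mult_right integrable_on_powr_from_0) auto
    show "norm (of_real (s powr (a - 1)) * \<phi> s) \<le> M * s powr (a - 1)" if "s \<in> {0..q}" for s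
      using mult_right_mono[OF M[OF that], of "s powr (a - 1)"] by (simp add: norm_mult mult.commute)
  qed auto
qed auto

text \<open>The difference equals \<open>y1 - f 0 * y2\<close>: on \<open>[0, q]\<close> the weight
  is combined with \<open>f - f 0\<close>, which tames its singularity, while on
  \<open>[q, R]\<close> only the constant \<open>f 0\<close> is left in front of the bare weight.
  The bound does not involve \<open>R\<close>, which can therefore be sent to infinity.\<close>

lemma gauss_integral_remainder:
  fixes f f' :: "real \<Rightarrow> complex" and l :: complex
  assumes mu: "0 < \<mu>" "\<mu> < 1" and q: "0 < q" "q \<le> R" and l: "Re l \<ge> 0" "l \<noteq> 0"
    and f: "continuous_on {0..q} f" "f q = 0"
    and f': "\<And>s. s \<in> {0<..<q} \<Longrightarrow> (f has_vector_derivative f' s) (at s)"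
    and W: "\<And>s. s \<in> {0<..<q} \<Longrightarrow> norm (f' s) \<le> W"
  shows "norm (integral {0..q} (\<lambda>s. of_real (s powr (\<mu> - 1)) * (f s * exp (- (l * of_real (s\<^sup>2)))))
      - f 0 * integral {0..R} (\<lambda>s. of_real (s powr (\<mu> - 1)) * exp (- (l * of_real (s\<^sup>2)))))
    \<le> 4 * W * q powr \<mu> / (\<mu> * sqrt (norm l))"
proof -
  define e where "e = (\<lambda>s::real. exp (- (l * of_real (s\<^sup>2))))"
  define E where "E = (\<lambda>s. integral {s..R} e)"
  define K where "K = 2 / sqrt (norm l)"
  define H where "H = (\<lambda>s. complex_of_real (s powr (\<mu> - 1)))"
  define H' where "H' = (\<lambda>s. complex_of_real ((\<mu> - 1) * s powr (\<mu> - 2)))"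
  define G where "G = (\<lambda>s. H s * (f s - f 0))"
  \<comment> \<open>The hypotheses control \<open>f'\<close> only inside the interval; the value 0
    at the end points lets the bound on \<open>G'\<close> hold on all of
    \<open>[0, q]\<close>.\<close>
  define G' where "G' = (\<lambda>s. if s \<in> {0<..<q} then H' s * (f s - f 0) + H s * f' s else 0)"
  have e_cont: "continuous_on X e" for X unfolding e_def by (intro continuous_intros)
  have K: "K > 0" using l by (simp add: K_def)
  have E_le: "norm (E s) \<le> K" if "s \<in> {0..R}" for s
    using norm_integral_gauss_le[OF l, of s R] that by (simp add: E_def K_def e_def)
  have E_deriv: "(E has_vector_derivative - e s) (at s within {0..R})" if "s \<in> {0..R}" for s
    unfolding E_def using that by (intro integral_has_vector_derivative' e_cont)
  have E_cont: "continuous_on {0..R} E"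
    using E_deriv by (meson continuous_on_eq_continuous_within has_vector_derivative_continuous)
  have E_deriv': "(E has_vector_derivative - e s) (at s)" if "s \<in> {0<..<R}" for s
    using E_deriv[of s] that by (simp add: at_within_Icc_at)
  have W0: "W \<ge> 0" using order_trans[OF norm_ge_zero W[of "q / 2"]] q by simp
  have lip: "norm (f s - f 0) \<le> W * s" if "s \<in> {0..q}" for s
  proof (cases "s = 0")
    case False
    have "norm (f s - f 0) \<le> W * s - W * 0"
      using that False f'
      by (intro differentiable_bound_general[where f' = f' and \<phi>' = "\<lambda>_. W"])
        (auto intro!: continuous_intros continuous_on_subset[OF f(1)] W derivative_eq_intros
          simp flip: has_real_derivative_iff_has_vector_derivative)
    then show ?thesis by simp
  qed simp
  have H_deriv: "(H has_vector_derivative H' s) (at s)" if "s > 0" for s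
    unfolding H_def H'_def using that
    by (intro has_vector_derivative_of_real)
      (auto intro!: derivative_eq_intros simp flip: has_real_derivative_iff_has_vector_derivative)
  have H_cont: "continuous_on X H" if "X \<subseteq> {0<..}" for X
    using H_deriv that
    by (meson continuous_at_imp_continuous_on greaterThan_iff has_vector_derivative_continuous subsetD)
  have G_le: "norm (G s) \<le> W * s powr \<mu>" if "s \<in> {0..q}" for s
  proof (cases "s = 0")
    case False
    have "norm (G s) \<le> s powr (\<mu> - 1) * (W * s)"
      unfolding G_def H_def norm_mult using lip[OF that] by (intro mult_mono) auto
    with False that show ?thesis by (simp add: powr_diff mult.commute)
  qed (simp add: G_def)
  \<comment> \<open>The only delicate point is 0, where \<open>H\<close> is unbounded nearby. There
    \<open>G 0 = 0\<close>, and \<open>|G s| \<le> W * s powr \<mu>\<close> squeezes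
    \<open>G\<close> to 0 because \<mu> is positive.\<close>
  have G_cont: "continuous_on {0..q} G"
    unfolding continuous_on_eq_continuous_within
  proof
    fix s assume s: "s \<in> {0..q}"
    show "continuous (at s within {0..q}) G"
    proof (cases "s = 0")
      case True
      have "continuous_on {0..q} (\<lambda>s. W * s powr \<mu>)"
        using mu by (intro continuous_intros continuous_on_powr') auto
      then have "((\<lambda>s. W * s powr \<mu>) \<longlongrightarrow> W * 0 powr \<mu>) (at 0 within {0..q})"
        unfolding continuous_on_def by (rule bspec) (use q in simp)
      then have "(G \<longlongrightarrow> 0) (at 0 within {0..q})"
        by (intro Lim_null_comparison[of G "\<lambda>s. W * s powr \<mu>"])
          (use G_le in \<open>auto simp: eventually_at_filter\<close>)
      then show ?thesis using True by (simp add: continuous_within G_def)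
    next
      case False
      then have "isCont H s"
        using s by (intro has_vector_derivative_continuous[OF H_deriv]) auto
      then show ?thesis
        unfolding G_def using s f(1)
        by (intro continuous_intros) (auto simp: continuous_on_eq_continuous_within continuous_at_imp_continuous_at_within)
    qed
  qed
  have G_deriv: "(G has_vector_derivative G' s) (at s)" if "s \<in> {0<..<q}" for s
  proof -
    have "(G has_vector_derivative (H s * (f' s - 0) + H' s * (f s - f 0))) (at s)"
      unfolding G_def using that
      by (intro has_vector_derivative_mult H_deriv has_vector_derivative_diff f' has_vector_derivative_const) auto
    with that show ?thesis by (simp add: G'_def add.commute)
  qed
  have G'_le: "norm (G' s * E s) \<le> K * (2 - \<mu>) * W * s powr (\<mu> - 1)" if "s \<in> {0..q}" for s
  proof (cases "s \<in> {0<..<q}")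
    case True
    have "norm (H' s * (f s - f 0)) \<le> (1 - \<mu>) * s powr (\<mu> - 2) * (W * s)"
      unfolding H'_def norm_mult norm_of_real abs_mult
      using lip[of s] True mu by (intro mult_mono) auto
    also have "\<dots> = (1 - \<mu>) * W * s powr (\<mu> - 1)"
      using True by (simp add: powr_diff field_simps power2_eq_square)
    finally have 1: "norm (H' s * (f s - f 0)) \<le> (1 - \<mu>) * W * s powr (\<mu> - 1)" .
    have 2: "norm (H s * f' s) \<le> W * s powr (\<mu> - 1)"
      using mult_right_mono[OF W[OF True], of "s powr (\<mu> - 1)"] by (simp add: H_def norm_mult mult.commute)
    have "norm (G' s) \<le> (2 - \<mu>) * W * s powr (\<mu> - 1)"
      using norm_triangle_mono[OF 1 2] True by (simp add: G'_def algebra_simps)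
    then have "norm (G' s) * norm (E s) \<le> ((2 - \<mu>) * W * s powr (\<mu> - 1)) * K"
      using E_le[of s] True q mu W0 by (intro mult_mono) auto
    then show ?thesis by (simp add: norm_mult mult_ac)
  next
    case False
    then have "G' s = 0" by (auto simp: G'_def)
    then show ?thesis using K mu W0 by simp
  qed
  \<comment> \<open>The value given by parts, with no boundary term at 0 since
    \<open>G 0 = 0\<close>. Integrability of \<open>G' * E\<close> comes with the rule, although
    \<open>G'\<close> may blow up at 0.\<close>
  define y1 where "y1 = G q * E q + integral {0..q} (\<lambda>s. G s * e s)"
  have "((\<lambda>s. G s * - e s) has_integral - integral {0..q} (\<lambda>s. G s * e s)) {0..q}"
    unfolding mult_minus_right
    by (intro has_integral_neg integrable_integral integrable_continuous_real continuous_intros G_cont e_cont)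
  then have y1: "((\<lambda>s. G' s * E s) has_integral y1) {0..q}"
    using q
    by (intro integration_by_parts_interior[OF bounded_bilinear_mult, of 0 q G E _ "\<lambda>s. - e s"]
        G_cont continuous_on_subset[OF E_cont] G_deriv E_deriv')
      (auto simp: y1_def G_def)
  have "((\<lambda>s. s powr (\<mu> - 1)) has_integral q powr \<mu> / \<mu>) {0..q}"
    using has_integral_powr_from_0[of "\<mu> - 1" q] mu q by simp
  then have y1_le: "norm y1 \<le> K * (2 - \<mu>) * W * (q powr \<mu> / \<mu>)"
    by (intro has_integral_norm_le[OF y1 has_integral_mult_right G'_le])
  \<comment> \<open>Here the boundary term at \<open>R\<close> is absent because
    \<open>E R = 0\<close>.\<close>
  define y2 where "y2 = - H q * E q + integral {q..R} (\<lambda>s. H s * e s)"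
  have "((\<lambda>s. H s * - e s) has_integral - integral {q..R} (\<lambda>s. H s * e s)) {q..R}"
    unfolding mult_minus_right using q
    by (intro has_integral_neg integrable_integral integrable_continuous_real continuous_intros H_cont e_cont) auto
  then have y2: "((\<lambda>s. H' s * E s) has_integral y2) {q..R}"
    using q
    by (intro integration_by_parts_interior[OF bounded_bilinear_mult, of q R H E _ "\<lambda>s. - e s"]
        H_cont continuous_on_subset[OF E_cont] H_deriv E_deriv')
      (auto simp: y2_def E_def)
  have y2_le: "norm y2 \<le> K * q powr (\<mu> - 1)"
  proof -
    have "((\<lambda>s. (1 - \<mu>) * s powr (\<mu> - 2)) has_integral (- (R powr (\<mu> - 1)) - - (q powr (\<mu> - 1)))) {q..R}"
      using q by (intro fundamental_theorem_of_calculus)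
       (auto intro!: derivative_eq_intros simp: algebra_simps simp flip: has_real_derivative_iff_has_vector_derivative)
    then have "norm y2 \<le> K * (- (R powr (\<mu> - 1)) - - (q powr (\<mu> - 1)))"
    proof (rule has_integral_norm_le[OF y2 has_integral_mult_right])
      show "norm (H' s * E s) \<le> K * ((1 - \<mu>) * s powr (\<mu> - 2))" if "s \<in> {q..R}" for s
        using mult_left_mono[OF E_le[of s], of "(1 - \<mu>) * s powr (\<mu> - 2)"] that q mu
        unfolding H'_def norm_mult norm_of_real abs_mult by (simp add: mult_ac)
    qed
    also have "\<dots> \<le> K * q powr (\<mu> - 1)" using K by simp
    finally show ?thesis .
  qed
  \<comment> \<open>Using \<open>f q = 0\<close>, this gives the tail \<open>f 0 * y2\<close> the
    same order \<open>q powr \<mu>\<close> as \<open>y1\<close>.\<close>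
  have f0: "norm (f 0) \<le> W * q" using lip[of q] q f(2) by (simp add: norm_minus_commute)
  have int_He: "(\<lambda>s. H s * e s) integrable_on {0..q}" "(\<lambda>s. H s * e s) integrable_on {0..R}"
    unfolding H_def using mu by (intro integrable_powr_mult_continuous e_cont; simp)+
  have int_Hfe: "(\<lambda>s. H s * (f s * e s)) integrable_on {0..q}"
    unfolding H_def using mu by (intro integrable_powr_mult_continuous continuous_intros f e_cont)
  have "integral {0..q} (\<lambda>s. G s * e s) = integral {0..q} (\<lambda>s. H s * (f s * e s) - f 0 * (H s * e s))"
    by (simp add: G_def algebra_simps)
  also have "\<dots> = integral {0..q} (\<lambda>s. H s * (f s * e s)) - f 0 * integral {0..q} (\<lambda>s. H s * e s)"
    by (simp add: integral_diff int_Hfe int_He integrable_on_mult_right)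
  finally have int_G: "integral {0..q} (\<lambda>s. G s * e s) = \<dots>" .
  have Gq: "G q = - (H q * f 0)" by (simp add: G_def f(2))
  have "integral {0..R} (\<lambda>s. H s * e s) =
      integral {0..q} (\<lambda>s. H s * e s) + integral {q..R} (\<lambda>s. H s * e s)"
    using Henstock_Kurzweil_Integration.integral_combine[OF _ q(2) int_He(2)] q by simp
  \<comment> \<open>The term \<open>G q * E q = - H q * f 0 * E q\<close> of \<open>y1\<close>
    cancels against the boundary term of \<open>f 0 * y2\<close>.\<close>
  then have "integral {0..q} (\<lambda>s. H s * (f s * e s)) - f 0 * integral {0..R} (\<lambda>s. H s * e s)
      = y1 - f 0 * y2"
    unfolding y1_def y2_def int_G Gq by (simp add: algebra_simps)
  also have "norm \<dots> \<le> norm y1 + norm (f 0) * norm y2"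
    using norm_triangle_ineq4[of y1 "f 0 * y2"] by (simp add: norm_mult)
  also have "\<dots> \<le> K * (2 - \<mu>) * W * (q powr \<mu> / \<mu>) + (W * q) * (K * q powr (\<mu> - 1))"
    using y1_le y2_le f0 W0 q by (intro add_mono mult_mono) auto
  \<comment> \<open>The two contributions are \<open>(2 - \<mu>)/\<mu>\<close> and \<open>1\<close>
    times \<open>K * W * q powr \<mu>\<close>. They add up to the factor \<open>2/\<mu>\<close>, and
    \<open>K = 2 / sqrt |l|\<close>.\<close>
  also have "\<dots> = 4 * W * q powr \<mu> / (\<mu> * sqrt (norm l))"
    using q mu l by (simp add: K_def powr_diff field_simps)
  finally show ?thesis by (simp add: H_def e_def)
qed

section \<open>The limits \<open>R\<close> to infinity and \<open>l\<close> to the imaginary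
  axis\<close>

text \<open>Dominated convergence. The majorant decays only because \<open>Re l > 0\<close>; on the
  imaginary axis the modulus of the integrand would not be integrable, so this limit is taken
  first.\<close>

lemma tendsto_truncated_gauss_moment:
  fixes l :: complex
  assumes l: "Re l > 0" and mu: "\<mu> > 0"
  shows "(\<lambda>k. integral {0..real k} (\<lambda>s. of_real (s powr (\<mu> - 1)) * exp (- (l * of_real (s\<^sup>2)))))
    \<longlonglongrightarrow> of_real (Gamma (\<mu> / 2)) / 2 * l powr (- of_real (\<mu> / 2))"
proof -
  define g where "g = (\<lambda>s::real. complex_of_real (s powr (\<mu> - 1)) * exp (- (l * of_real (s\<^sup>2))))"
  define F where "F = (\<lambda>k s. if s \<in> {0..real k} then g s else 0)"
  have g: "(g has_integral of_real (Gamma (\<mu> / 2)) / 2 * l powr (- of_real (\<mu> / 2))) {0..}"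
    using has_integral_gauss_moment_complex[OF l, of "\<mu> / 2"] mu by (simp add: g_def)
  have "g integrable_on {0..real k}" for k
    unfolding g_def by (intro integrable_powr_mult_continuous mu continuous_intros)
  then have F: "F k integrable_on {0..}" for k
    unfolding F_def by (subst integrable_restrict_Int) (simp add: Int_absorb2 Int_absorb1)
  have dom: "(\<lambda>s. s powr (\<mu> - 1) * exp (- (Re l * s\<^sup>2))) integrable_on {0..}"
    using has_integral_gauss_moment[OF l, of "\<mu> / 2"] mu by (auto simp: has_integral_iff)
  have "norm (F k s) \<le> s powr (\<mu> - 1) * exp (- (Re l * s\<^sup>2))" for k s
    by (simp add: F_def g_def norm_mult)
  moreover have "(\<lambda>k. F k s) \<longlonglongrightarrow> g s" if "s \<in> {0..}" for s
  proof (rule tendsto_eventually)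
    show "\<forall>\<^sub>F k in sequentially. F k s = g s"
      using eventually_ge_at_top[of "nat \<lceil>s\<rceil>"] by eventually_elim (use that in \<open>simp add: F_def; linarith\<close>)
  qed
  ultimately have "(\<lambda>k. integral {0..} (F k)) \<longlonglongrightarrow> integral {0..} g"
    by (intro dominated_convergence(2)[OF F dom])
  moreover have "integral {0..} (F k) = integral {0..real k} g" for k
    unfolding F_def by (subst integral_restrict_Int) (simp add: Int_absorb2 Int_absorb1)
  ultimately show ?thesis
    using g by (simp add: integral_unique) (simp add: g_def)
qed

lemma gauss_integral_expansion:
  fixes f f' :: "real \<Rightarrow> complex" and l :: complex
  assumes mu: "0 < \<mu>" "\<mu> < 1" and q: "0 < q" and l: "Re l > 0"
    and f: "continuous_on {0..q} f" "f q = 0"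
    and f': "\<And>s. s \<in> {0<..<q} \<Longrightarrow> (f has_vector_derivative f' s) (at s)"
    and W: "\<And>s. s \<in> {0<..<q} \<Longrightarrow> norm (f' s) \<le> W"
  shows "norm (integral {0..q} (\<lambda>s. of_real (s powr (\<mu> - 1)) * (f s * exp (- (l * of_real (s\<^sup>2)))))
      - f 0 * (of_real (Gamma (\<mu> / 2)) / 2 * l powr (- of_real (\<mu> / 2))))
    \<le> 4 * W * q powr \<mu> / (\<mu> * sqrt (norm l))"
proof (rule tendsto_upperbound)
  show "(\<lambda>k. norm (integral {0..q} (\<lambda>s. of_real (s powr (\<mu> - 1)) * (f s * exp (- (l * of_real (s\<^sup>2)))))
      - f 0 * integral {0..real k} (\<lambda>s. of_real (s powr (\<mu> - 1)) * exp (- (l * of_real (s\<^sup>2))))))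
    \<longlonglongrightarrow> norm (integral {0..q} (\<lambda>s. of_real (s powr (\<mu> - 1)) * (f s * exp (- (l * of_real (s\<^sup>2)))))
      - f 0 * (of_real (Gamma (\<mu> / 2)) / 2 * l powr (- of_real (\<mu> / 2))))"
    by (intro tendsto_intros tendsto_truncated_gauss_moment l mu)
  show "\<forall>\<^sub>F k in sequentially. norm (integral {0..q} (\<lambda>s. of_real (s powr (\<mu> - 1)) * (f s * exp (- (l * of_real (s\<^sup>2)))))
      - f 0 * integral {0..real k} (\<lambda>s. of_real (s powr (\<mu> - 1)) * exp (- (l * of_real (s\<^sup>2)))))
    \<le> 4 * W * q powr \<mu> / (\<mu> * sqrt (norm l))"
    using eventually_ge_at_top[of "nat \<lceil>q\<rceil>"]
  proof eventually_elim
    case (elim k)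
    then have "q \<le> real k" by linarith
    moreover have "l \<noteq> 0" using l by auto
    ultimately show ?case
      using gauss_integral_remainder[OF mu q _ _ _ f f' W, of "real k" l] l by auto
  qed
qed simp

text \<open>The parameter approaches \<open>\<i> * t\<close> from the right half-plane. Only the
  integral over the bounded interval \<open>[0, q]\<close> and the closed form of the moment must
  converge, so no oscillatory integral over the half-line arises.\<close>

lemma fresnel_integral_expansion:
  fixes f f' :: "real \<Rightarrow> complex" and t :: real
  assumes mu: "0 < \<mu>" "\<mu> < 1" and q: "0 < q" and t: "t > 0"
    and f: "continuous_on {0..q} f" "f q = 0"
    and f': "\<And>s. s \<in> {0<..<q} \<Longrightarrow> (f has_vector_derivative f' s) (at s)"
    and W: "\<And>s. s \<in> {0<..<q} \<Longrightarrow> norm (f' s) \<le> W"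
  shows "norm (integral {0..q} (\<lambda>s. of_real (s powr (\<mu> - 1)) * (f s * exp (- (\<i> * of_real (t * s\<^sup>2)))))
      - of_real (Gamma (\<mu> / 2)) / 2 * exp (- (\<i> * of_real (pi * \<mu> / 4))) * f 0 * of_real (t powr (- \<mu> / 2)))
    \<le> 4 * W * q powr \<mu> / (\<mu> * sqrt t)"
proof -
  define l where "l = (\<lambda>n. of_real (inverse (real (Suc n))) + \<i> * of_real t)"
  define I where "I = (\<lambda>z. integral {0..q} (\<lambda>s. of_real (s powr (\<mu> - 1)) * (f s * exp (- (z * of_real (s\<^sup>2))))))"
  define J where "J = (\<lambda>z. f 0 * (of_real (Gamma (\<mu> / 2)) / 2 * z powr (- of_real (\<mu> / 2))))"
  have Re_l: "Re (l n) > 0" for n by (simp add: l_def)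
  have "(\<lambda>n. inverse (real (Suc n))) \<longlonglongrightarrow> 0" by (rule LIMSEQ_inverse_real_of_nat)
  then have "l \<longlonglongrightarrow> of_real 0 + \<i> * of_real t"
    unfolding l_def by (intro tendsto_intros)
  then have l_lim: "l \<longlonglongrightarrow> \<i> * of_real t" by simp
  obtain M where M: "\<And>s. s \<in> {0..q} \<Longrightarrow> norm (f s) \<le> M"
    using compact_imp_bounded[OF compact_continuous_image[OF f(1) compact_Icc]]
    unfolding bounded_iff by blast
  have I_lim: "(\<lambda>n. I (l n)) \<longlonglongrightarrow> I (\<i> * of_real t)"
    unfolding I_def
  proof (rule dominated_convergence(2))
    show "(\<lambda>s. of_real (s powr (\<mu> - 1)) * (f s * exp (- (l n * of_real (s\<^sup>2))))) integrable_on {0..q}" for n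
      by (intro integrable_powr_mult_continuous mu continuous_intros f)
    show "(\<lambda>s. s powr (\<mu> - 1) * M) integrable_on {0..q}"
      using mu q by (intro integrable_on_mult_left integrable_on_powr_from_0) auto
    show "norm (of_real (s powr (\<mu> - 1)) * (f s * exp (- (l n * of_real (s\<^sup>2))))) \<le> s powr (\<mu> - 1) * M"
      if "s \<in> {0..q}" for n s
    proof -
      have "norm (f s) * exp (- (Re (l n) * s\<^sup>2)) \<le> M * 1"
        using M[OF that] Re_l[of n] by (intro mult_mono order_trans[OF norm_ge_zero M[OF that]]) auto
      then show ?thesis by (simp add: norm_mult mult_left_mono)
    qed
    show "(\<lambda>n. of_real (s powr (\<mu> - 1)) * (f s * exp (- (l n * of_real (s\<^sup>2)))))
      \<longlonglongrightarrow> of_real (s powr (\<mu> - 1)) * (f s * exp (- (\<i> * of_real t * of_real (s\<^sup>2))))" for s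
      by (intro tendsto_intros l_lim)
  qed
  \<comment> \<open>The limit lies off the branch cut, so the principal power is continuous
    there.\<close>
  have "\<i> * of_real t \<notin> \<real>\<^sub>\<le>\<^sub>0"
    using t by (auto simp: complex_nonpos_Reals_iff)
  then have J_lim: "(\<lambda>n. J (l n)) \<longlonglongrightarrow> J (\<i> * of_real t)"
    unfolding J_def by (intro tendsto_intros l_lim disjI1)
  have "norm (I (\<i> * of_real t) - J (\<i> * of_real t)) \<le> 4 * W * q powr \<mu> / (\<mu> * sqrt (norm (\<i> * of_real t)))"
  proof (rule LIMSEQ_le)
    show "(\<lambda>n. norm (I (l n) - J (l n))) \<longlonglongrightarrow> norm (I (\<i> * of_real t) - J (\<i> * of_real t))"
      by (intro tendsto_intros I_lim J_lim)
    show "(\<lambda>n. 4 * W * q powr \<mu> / (\<mu> * sqrt (norm (l n)))) \<longlonglongrightarrow>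
        4 * W * q powr \<mu> / (\<mu> * sqrt (norm (\<i> * of_real t)))"
      using mu t by (intro tendsto_intros l_lim) auto
    show "\<exists>N. \<forall>n\<ge>N. norm (I (l n) - J (l n)) \<le> 4 * W * q powr \<mu> / (\<mu> * sqrt (norm (l n)))"
      unfolding I_def J_def using gauss_integral_expansion[OF mu q Re_l f f' W] by blast
  qed
  also have "I (\<i> * of_real t) =
      integral {0..q} (\<lambda>s. of_real (s powr (\<mu> - 1)) * (f s * exp (- (\<i> * of_real (t * s\<^sup>2)))))"
    by (simp add: I_def mult.assoc)
  also have "J (\<i> * of_real t) =
      of_real (Gamma (\<mu> / 2)) / 2 * exp (- (\<i> * of_real (pi * \<mu> / 4))) * f 0 * of_real (t powr (- \<mu> / 2))"
  proof -
    \<comment> \<open>\<open>Ln \<i>\<close> is \<open>\<i>\<close> times \<open>pi / 2\<close>,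
      which produces the phase with angle \<open>- pi * \<mu> / 4\<close>.\<close>
    have "(\<i> * of_real t) powr (- of_real (\<mu> / 2)) = exp (- of_real (\<mu> / 2) * (Ln \<i> + of_real (ln t)))"
      using t by (simp add: powr_def Ln_times_of_real Ln_of_real mult.commute[of \<i>] add.commute)
    also have "\<dots> = exp (- (\<i> * of_real (pi * \<mu> / 4))) * of_real (exp (- \<mu> / 2 * ln t))"
      unfolding exp_of_real[symmetric] exp_add[symmetric] by (simp add: algebra_simps)
    finally show ?thesis using t by (simp add: J_def powr_def)
  qed
  finally show ?thesis using t by (simp add: norm_mult)
qed

section \<open>Essential suprema and the sup norm\<close>

text \<open>A negative essential supremum would make a norm negative almost everywhere, hence make
  the interval null, against its length \<open>b - a > 0\<close>.\<close>

lemma esssup_norm_nonneg: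
  fixes a b :: real
  assumes "a < b"
  shows "0 \<le> esssup (lebesgue_on {a<..<b}) (\<lambda>x. ereal (norm (f x)))"
    (is "0 \<le> esssup ?M ?f")
proof (rule ccontr)
  assume neg: "\<not> 0 \<le> esssup ?M ?f"
  have "AE x in ?M. ?f x \<le> esssup ?M ?f" by (rule esssup_AE)
  then have "AE x in ?M. False"
  proof (rule eventually_mono)
    fix x assume "?f x \<le> esssup ?M ?f"
    with neg have "?f x < 0" by (meson not_le order.trans)
    then show False by (simp add: zero_ereal_def)
  qed
  then have "emeasure ?M (space ?M) = 0"
    unfolding ae_filter_eq_bot_iff[symmetric] trivial_limit_def .
  moreover have "emeasure ?M (space ?M) = ennreal (b - a)"
    using assms by (subst emeasure_restrict_space) auto
  ultimately show False using assms by simp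
qed

lemma Linf_norm_nonneg: "a < b \<Longrightarrow> 0 \<le> Linf_norm a b f"
  unfolding Linf_norm_def by (intro real_of_ereal_pos esssup_norm_nonneg)

text \<open>The set where a continuous function exceeds its essential supremum is open and null,
  hence empty. The bound \<open>M\<close> keeps the supremum finite, as \<open>real_of_ereal\<close>
  would send infinity to 0.\<close>

lemma norm_le_Linf_norm:
  fixes f :: "real \<Rightarrow> 'a::euclidean_space"
  assumes cont: "continuous_on {a<..<b} f" and M: "\<And>y. y \<in> {a<..<b} \<Longrightarrow> norm (f y) \<le> M"
    and x: "x \<in> {a<..<b}"
  shows "norm (f x) \<le> Linf_norm a b f"
proof (rule ccontr)
  let ?M = "lebesgue_on {a<..<b}" and ?f = "\<lambda>x. ereal (norm (f x))"
  assume less: "\<not> norm (f x) \<le> Linf_norm a b f"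
  have "f \<in> borel_measurable ?M"
    using cont by (intro continuous_imp_measurable_on_sets_lebesgue) auto
  then have meas: "?f \<in> borel_measurable ?M" by measurable
  then have le: "esssup ?M ?f \<le> ereal M"
    by (rule esssup_I) (auto simp: AE_restrict_space_iff M)
  have "0 \<le> esssup ?M ?f" using x by (intro esssup_norm_nonneg) auto
  with le have "\<bar>esssup ?M ?f\<bar> \<noteq> \<infinity>" by auto
  then have "esssup ?M ?f = ereal (Linf_norm a b f)"
    by (simp add: Linf_norm_def ereal_real)
  with esssup_AE[where M = ?M and f = ?f]
  have "AE y in ?M. norm (f y) \<le> Linf_norm a b f" by simp
  then have ae: "AE y in lebesgue. y \<in> {a<..<b} \<longrightarrow> norm (f y) \<le> Linf_norm a b f"
    by (simp add: AE_restrict_space_iff)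
  define U where "U = {y \<in> {a<..<b}. Linf_norm a b f < norm (f y)}"
  have aeU: "AE y in lebesgue. y \<notin> U"
    using ae by (rule eventually_mono) (auto simp: U_def)
  have "open U"
  proof -
    have "open ((\<lambda>y. norm (f y)) -` {Linf_norm a b f<..} \<inter> {a<..<b})"
      using cont by (intro continuous_on_open_vimage[THEN iffD1, rule_format] continuous_on_norm) auto
    moreover have "(\<lambda>y. norm (f y)) -` {Linf_norm a b f<..} \<inter> {a<..<b} = U"
      by (auto simp: U_def)
    ultimately show ?thesis by simp
  qed
  with aeU have "negligible U"
    by (simp add: negligible_iff_null_sets AE_iff_null_sets)
  with \<open>open U\<close> have "U = {}" using open_not_negligible by blast
  with x less show False by (auto simp: U_def)
qed

section \<open>The Schroedinger solution on the ray\<close>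

theorem theorem2p6:
  fixes \<mu> p1 p2 \<eta> :: real and u0 ut :: "real \<Rightarrow> complex" and \<nu> :: "real \<Rightarrow> real"
  assumes "0 < \<mu>" and "\<mu> < 1"
    and "p1 < p2"
    and "\<And>p. p \<notin> {p1..p2} \<Longrightarrow> fourier_transform u0 p = 0"
    and "\<And>p. p \<in> {p1<..p2} \<Longrightarrow>
           fourier_transform u0 p = complex_of_real ((p - p1) powr (\<mu> - 1)) * ut p"
    and "Ck_on 1 ut {p1..p2}"
    and "ut p1 \<noteq> 0"
    and "fourier_transform u0 p2 = 0"
    and "0 < \<eta>" and "\<eta> < (p2 - p1) / 2"
    and "cutoff p1 p2 \<eta> \<nu>"
  shows "0 \<le> c_const \<mu> p1 p2 \<eta> \<nu> ut \<and>
    (\<forall>t x. 0 < t \<and> x = 2 * p1 * t \<longrightarrow>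
       norm (schroedinger_solution p1 p2 u0 t x
              - L_coeff \<mu> p1 ut t * complex_of_real (t powr (- \<mu> / 2)))
       \<le> c_const \<mu> p1 p2 \<eta> \<nu> ut * (t powr (- 1) + t powr (- 1 / 2)))"
proof -
  define q where "q = p2 - p1"
  define W where "W = W1inf_norm p1 p2 ut"
  define N where "N = Linf_norm p1 p2 (deriv \<nu>)"
  define B where "B = q powr \<mu> * W / \<mu>"
  have q: "q > 0" using assms(3) by (simp add: q_def)
  obtain g where g: "\<And>x. x \<in> {p1..p2} \<Longrightarrow> (ut has_vector_derivative g x) (at x within {p1..p2})"
    and g_cont: "continuous_on {p1..p2} g"
    using assms(6) unfolding One_nat_def Ck_on.simps by blast
  have ut_cont: "continuous_on {p1..p2} ut"
    using g by (meson continuous_on_eq_continuous_within has_vector_derivative_continuous)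
  have g': "(ut has_vector_derivative g x) (at x)" if "x \<in> {p1<..<p2}" for x
    using g[of x] that by (simp add: at_within_Icc_at)
  have g_le: "norm (g x) \<le> W" if x: "x \<in> {p1<..<p2}" for x
  proof -
    obtain M where M: "\<And>y. y \<in> {p1..p2} \<Longrightarrow> norm (g y) \<le> M"
      using compact_imp_bounded[OF compact_continuous_image[OF g_cont compact_Icc]]
      unfolding bounded_iff by blast
    have eq: "vector_derivative ut (at y) = g y" if "y \<in> {p1<..<p2}" for y
      using g'[OF that] by (rule vector_derivative_at)
    have "norm (vector_derivative ut (at x)) \<le> Linf_norm p1 p2 (\<lambda>y. vector_derivative ut (at y))"
      using x M eq
      by (intro norm_le_Linf_norm[where M = M]
          continuous_on_eq[OF continuous_on_subset[OF g_cont]]) auto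
    with eq[OF x] show ?thesis by (simp add: W_def W1inf_norm_def)
  qed
  have W: "W \<ge> 0" using Linf_norm_nonneg[OF assms(3), of ut] by (simp add: W_def W1inf_norm_def)
  have N: "N \<ge> 0" using Linf_norm_nonneg[OF assms(3)] by (simp add: N_def)
  have B: "B \<ge> 0" using W assms(1) by (simp add: B_def)
  \<comment> \<open>The left side is the second summand of \<open>c_const\<close> without its factor
    \<open>N + 1 \<ge> 1\<close>; the first summand is nonnegative.\<close>
  have c: "sqrt pi / 2 * B \<le> c_const \<mu> p1 p2 \<eta> \<nu> ut"
  proof -
    have "sqrt pi / 2 * B \<le> sqrt pi / 2 * B * (N + 1)"
      using mult_left_mono[of 1 "N + 1" "sqrt pi / 2 * B"] B N by simp
    also have "\<dots> \<le> q\<^sup>2 / 2 * \<eta> powr (\<mu> - 3) * W * (N + (2 - \<mu>) * inverse \<eta> + 1)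
        + sqrt pi / 2 * B * (N + 1)"
      using W N assms by simp
    also have "\<dots> = c_const \<mu> p1 p2 \<eta> \<nu> ut"
      by (simp add: c_const_def B_def q_def W_def N_def)
    finally show ?thesis .
  qed
  with B have c0: "0 \<le> c_const \<mu> p1 p2 \<eta> \<nu> ut" by (smt (verit) mult_nonneg_nonneg pi_ge_zero real_sqrt_ge_zero divide_nonneg_nonneg)
  have main: "norm (schroedinger_solution p1 p2 u0 t (2 * p1 * t)
              - L_coeff \<mu> p1 ut t * complex_of_real (t powr (- \<mu> / 2)))
       \<le> c_const \<mu> p1 p2 \<eta> \<nu> ut * (t powr (- 1) + t powr (- 1 / 2))" if t: "t > 0" for t
  proof -
    define f where "f = (\<lambda>s. ut (p1 + s))"
    define I where "I = integral {0..q} (\<lambda>s. of_real (s powr (\<mu> - 1)) * (f s * exp (- (\<i> * of_real (t * s\<^sup>2)))))"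
    define J where "J = of_real (Gamma (\<mu> / 2)) / 2 * exp (- (\<i> * of_real (pi * \<mu> / 4))) * f 0
      * of_real (t powr (- \<mu> / 2))"
    define \<omega> where "\<omega> = exp (\<i> * of_real (t * p1\<^sup>2))"
    define F where "F = (\<lambda>p. fourier_transform u0 p *
            exp (- (\<i> * complex_of_real (t * p\<^sup>2)) + \<i> * complex_of_real (2 * p1 * t * p)))"
    \<comment> \<open>The weight \<open>(p2 - p1) powr (\<mu> - 1)\<close> is nonzero, so the
      vanishing of the transform at \<open>p2\<close> passes to \<open>ut\<close>.\<close>
    have "ut p2 = 0"
      using assms(5)[of p2] assms(3,8) by simp
    then have fq: "f q = 0" by (simp add: f_def q_def)
    have f_cont: "continuous_on {0..q} f"
      unfolding f_def by (intro continuous_on_compose2[OF ut_cont] continuous_intros) (auto simp: q_def)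
    have f': "(f has_vector_derivative g (p1 + s)) (at s)" if "s \<in> {0<..<q}" for s
    proof -
      have "((ut \<circ> (\<lambda>s. p1 + s)) has_vector_derivative 1 *\<^sub>R g (p1 + s)) (at s)"
        using that by (intro vector_diff_chain_at g') (auto intro!: derivative_eq_intros simp: q_def)
      then show ?thesis by (simp add: f_def o_def)
    qed
    have IJ: "norm (I - J) \<le> 4 * W * q powr \<mu> / (\<mu> * sqrt t)"
      unfolding I_def J_def
      by (rule fresnel_integral_expansion[OF assms(1,2) q t f_cont fq f' g_le]) (auto simp: q_def)
    have "integral {p1..p2} F = integral {0..q} (F \<circ> (+) p1)"
      using integral_shift_Icc_real[of 0 q F p1] by (simp add: q_def)
    \<comment> \<open>On the ray the terms linear in \<open>s\<close> cancel, leaving the phase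
      \<open>t * p1^2 - t * s^2\<close>. The point \<open>s = 0\<close> is excepted because the
      transform is not prescribed at \<open>p1\<close>.\<close>
    also have "\<dots> = integral {0..q} (\<lambda>s. \<omega> * (of_real (s powr (\<mu> - 1)) * (f s * exp (- (\<i> * of_real (t * s\<^sup>2))))))"
    proof (rule integral_spike[of "{0}"])
      fix s assume "s \<in> {0..q} - {0}"
      then have "fourier_transform u0 (p1 + s) = of_real (s powr (\<mu> - 1)) * f s"
        using assms(5)[of "p1 + s"] by (auto simp: q_def f_def)
      moreover have "exp (- (\<i> * complex_of_real (t * (p1 + s)\<^sup>2)) + \<i> * complex_of_real (2 * p1 * t * (p1 + s)))
          = \<omega> * exp (- (\<i> * of_real (t * s\<^sup>2)))"
        unfolding \<omega>_def exp_add[symmetric] by (simp add: power2_eq_square algebra_simps)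
      ultimately show "\<omega> * (of_real (s powr (\<mu> - 1)) * (f s * exp (- (\<i> * of_real (t * s\<^sup>2))))) = (F \<circ> (+) p1) s"
        by (simp add: F_def)
    qed simp
    also have "\<dots> = \<omega> * I" by (simp add: I_def)
    finally have "schroedinger_solution p1 p2 u0 t (2 * p1 * t) = 1 / (2 * of_real pi) * (\<omega> * I)"
      unfolding schroedinger_solution_def F_def by (rule arg_cong)
    moreover have "L_coeff \<mu> p1 ut t * complex_of_real (t powr (- \<mu> / 2)) = 1 / (2 * of_real pi) * (\<omega> * J)"
      unfolding L_coeff_def J_def \<omega>_def f_def by simp
    ultimately have "schroedinger_solution p1 p2 u0 t (2 * p1 * t)
        - L_coeff \<mu> p1 ut t * complex_of_real (t powr (- \<mu> / 2)) = 1 / (2 * of_real pi) * (\<omega> * (I - J))"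
      by (simp only: right_diff_distrib)
    also have "norm \<dots> = norm (I - J) / (2 * pi)"
      by (simp add: norm_mult norm_divide \<omega>_def)
    also have "\<dots> \<le> (4 * W * q powr \<mu> / (\<mu> * sqrt t)) / (2 * pi)"
      using IJ by (intro divide_right_mono) auto
    also have "\<dots> = 2 / pi * B * (1 / sqrt t)"
      by (simp add: B_def mult_ac)
    also have "\<dots> \<le> sqrt pi / 2 * B * (1 / sqrt t)"
    proof -
      \<comment> \<open>The claim \<open>2 / pi \<le> sqrt pi / 2\<close> amounts to
        \<open>4 \<le> pi * sqrt pi\<close>, and the product is at least
        \<open>3 * 1.5 = 4.5\<close>.\<close>
      have "1.5 \<le> sqrt pi"
        using pi_gt3 by (intro real_le_rsqrt) (simp add: power2_eq_square)
      then have "3 * 1.5 \<le> pi * sqrt pi"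
        using pi_gt3 by (intro mult_mono) auto
      then have "2 / pi \<le> sqrt pi / 2" by (simp add: field_simps)
      then show ?thesis using B t by (intro mult_right_mono) auto
    qed
    also have "\<dots> \<le> c_const \<mu> p1 p2 \<eta> \<nu> ut * (t powr (- 1) + t powr (- 1 / 2))"
    proof (intro mult_mono c c0)
      have "t powr (- 1 / 2) = 1 / sqrt t"
        using t by (simp add: powr_minus_divide powr_half_sqrt)
      then show "1 / sqrt t \<le> t powr (- 1) + t powr (- 1 / 2)" by simp
    qed (use t in auto)
    finally show ?thesis .
  qed
  with c0 show ?thesis by blast
qed

end
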